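(* Let $n\ge1$ and $i\in\{1,\dots,n\}$. Then $$\mathit{Md}\cup\mathit{DE}\vdash \frac{\partial}{\partial X_i}(1/x)=-(1/x^2)\cdot\frac{\partial}{\partial X_i}(x),$$ where $x$ is a variable and $\vdash$ denotes derivability in equational logic.
   Context: The signature of meadows is $\Sigma_m=(0,1,+,\cdot,-,{}^{-1})$, with constants $0,1$, binary operations $+,\cdot$, and unary operations $-$ and ${}^{-1}$. For the fixed $n\ge1$, the signature $\Sigma_{md}$ extends $\Sigma_m$ with constants $X_1,\dots,X_n$ and unary operations $\frac{\partial}{\partial X_1},\dots,\frac{\partial}{\partial X_n}$. Notation: $1/t$ stands for $t^{-1}$ and $t^2$ for $t\cdot t$. $\mathit{Md}$ is the following set of equations (variables $x,y,z$ are implicitly universally quantified): $(x+y)+z=x+(y+z)$; $x+y=y+x$; $x+0=x$; $x+(-x)=0$; $(x\cdot y)\cdot z=x\cdot(y\cdot z)$; $x\cdot y=y\cdot x$; $1\cdot x=x$; $x\cdot(y+z)=x\cdot y+x\cdot z$; $(x^{-1})^{-1}=x$; $x\cdot(x\cdot x^{-1})=x$. $\mathit{DE}$ is the following set of equations, for all $i,j\in\{1,\dots,n\}$: (D1) $\frac{\partial}{\partial X_i}(x+y)=\frac{\partial}{\partial X_i}(x)+\frac{\partial}{\partial X_i}(y)$; (D2) $\frac{\partial}{\partial X_i}(x\cdot y)=\frac{\partial}{\partial X_i}(x)\cdot y+x\cdot\frac{\partial}{\partial X_i}(y)$; (D3) $\frac{\partial}{\partial X_i}(x\cdot x^{-1})=0$;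 (D4) $\frac{\partial}{\partial X_i}(X_i)=1$; (D5) $\frac{\partial}{\partial X_i}(X_j)=0$ if $i\ne j$. Derivability in equational logic uses reflexivity, symmetry, transitivity, congruence for all operations of $\Sigma_{md}$, and substitution. Equivalently (by Birkhoff completeness), the displayed equation holds for all $x$ in every $\Sigma_{md}$-algebra satisfying $\mathit{Md}\cup\mathit{DE}$. *)

theory Defs
  imports Main
begin

text \<open>
  Raw terms carry an arbitrary natural number as index of an indeterminate or a partial derivation;
  the terms over the signature with \<open>n\<close> indeterminates are those satisfying \<open>wf_trm n\<close> below.
\<close>

datatype trm =
    Var nat
  | Zero ("\<^bold>0")
  | One ("\<^bold>1")
  | Add trm trm (infixl "\<^bold>+" 65)
  | Mul trm trm (infixl "\<^bold>\<cdot>" 70)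
  | Neg trm ("\<^bold>- _" [81] 80)
  | Inv trm ("_\<^bold>\<inverse>" [1000] 999)
  | Indet nat
  | Pd nat trm

abbreviation Sq :: "trm \<Rightarrow> trm" where
  "Sq t \<equiv> t \<^bold>\<cdot> t"

primrec wf_trm :: "nat \<Rightarrow> trm \<Rightarrow> bool" where
  "wf_trm n (Var v) \<longleftrightarrow> True"
| "wf_trm n \<^bold>0 \<longleftrightarrow> True"
| "wf_trm n \<^bold>1 \<longleftrightarrow> True"
| "wf_trm n (s \<^bold>+ t) \<longleftrightarrow> wf_trm n s \<and> wf_trm n t"
| "wf_trm n (s \<^bold>\<cdot> t) \<longleftrightarrow> wf_trm n s \<and> wf_trm n t"
| "wf_trm n (\<^bold>- t) \<longleftrightarrow> wf_trm n t"
| "wf_trm n (t\<^bold>\<inverse>) \<longleftrightarrow> wf_trm n t"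
| "wf_trm n (Indet i) \<longleftrightarrow> i \<in> {1..n}"
| "wf_trm n (Pd i t) \<longleftrightarrow> i \<in> {1..n} \<and> wf_trm n t"

primrec subst :: "(nat \<Rightarrow> trm) \<Rightarrow> trm \<Rightarrow> trm" where
  "subst \<sigma> (Var v) = \<sigma> v"
| "subst \<sigma> \<^bold>0 = \<^bold>0"
| "subst \<sigma> \<^bold>1 = \<^bold>1"
| "subst \<sigma> (s \<^bold>+ t) = subst \<sigma> s \<^bold>+ subst \<sigma> t"
| "subst \<sigma> (s \<^bold>\<cdot> t) = subst \<sigma> s \<^bold>\<cdot> subst \<sigma> t"
| "subst \<sigma> (\<^bold>- t) = \<^bold>- (subst \<sigma> t)"
| "subst \<sigma> (t\<^bold>\<inverse>) = (subst \<sigma> t)\<^bold>\<inverse>"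
| "subst \<sigma> (Indet i) = Indet i"
| "subst \<sigma> (Pd i t) = Pd i (subst \<sigma> t)"

text \<open>An equation is a pair of terms; its variables are implicitly universally quantified.\<close>

type_synonym equation = "trm \<times> trm"

definition Md :: "equation set" where
  "Md = (let x = Var 0; y = Var 1; z = Var 2 in
    {((x \<^bold>+ y) \<^bold>+ z, x \<^bold>+ (y \<^bold>+ z)),
     (x \<^bold>+ y, y \<^bold>+ x),
     (x \<^bold>+ \<^bold>0, x),
     (x \<^bold>+ (\<^bold>- x), \<^bold>0),
     ((x \<^bold>\<cdot> y) \<^bold>\<cdot> z, x \<^bold>\<cdot> (y \<^bold>\<cdot> z)),
     (x \<^bold>\<cdot> y, y \<^bold>\<cdot> x),
     (\<^bold>1 \<^bold>\<cdot> x, x),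
     (x \<^bold>\<cdot> (y \<^bold>+ z), x \<^bold>\<cdot> y \<^bold>+ x \<^bold>\<cdot> z),
     ((x\<^bold>\<inverse>)\<^bold>\<inverse>, x),
     (x \<^bold>\<cdot> (x \<^bold>\<cdot> x\<^bold>\<inverse>), x)})"

definition DE :: "nat \<Rightarrow> equation set" where
  "DE n = (let x = Var 0; y = Var 1 in
     {(Pd i (x \<^bold>+ y), Pd i x \<^bold>+ Pd i y) | i. i \<in> {1..n}}
   \<union> {(Pd i (x \<^bold>\<cdot> y), Pd i x \<^bold>\<cdot> y \<^bold>+ x \<^bold>\<cdot> Pd i y) | i. i \<in> {1..n}}
   \<union> {(Pd i (x \<^bold>\<cdot> x\<^bold>\<inverse>), \<^bold>0) | i. i \<in> {1..n}}
   \<union> {(Pd i (Indet i), \<^bold>1) | i. i \<in> {1..n}}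
   \<union> {(Pd i (Indet j), \<^bold>0) | i j. i \<in> {1..n} \<and> j \<in> {1..n} \<and> i \<noteq> j})"

text \<open>
  Derivability in equational logic over the signature with \<open>n\<close> indeterminates: every term introduced
  by a rule has to belong to that signature.
\<close>

inductive derivable :: "nat \<Rightarrow> equation set \<Rightarrow> trm \<Rightarrow> trm \<Rightarrow> bool"
  for n :: nat and E :: "equation set" where
  axiom: "(s, t) \<in> E \<Longrightarrow> wf_trm n s \<Longrightarrow> wf_trm n t \<Longrightarrow> derivable n E s t"
| refl: "wf_trm n t \<Longrightarrow> derivable n E t t"
| sym: "derivable n E s t \<Longrightarrow> derivable n E t s"
| trans: "derivable n E s t \<Longrightarrow> derivable n E t u \<Longrightarrow> derivable n E s u"
| cong_Add: "derivable n E s s' \<Longrightarrow> derivable n E t t' \<Longrightarrow> derivable n E (s \<^bold>+ t) (s' \<^bold>+ t')"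
| cong_Mul: "derivable n E s s' \<Longrightarrow> derivable n E t t' \<Longrightarrow> derivable n E (s \<^bold>\<cdot> t) (s' \<^bold>\<cdot> t')"
| cong_Neg: "derivable n E t t' \<Longrightarrow> derivable n E (\<^bold>- t) (\<^bold>- t')"
| cong_Inv: "derivable n E t t' \<Longrightarrow> derivable n E (t\<^bold>\<inverse>) (t'\<^bold>\<inverse>)"
| cong_Pd: "i \<in> {1..n} \<Longrightarrow> derivable n E t t' \<Longrightarrow> derivable n E (Pd i t) (Pd i t')"
| subst: "derivable n E s t \<Longrightarrow> (\<And>v. wf_trm n (\<sigma> v)) \<Longrightarrow> derivable n E (subst \<sigma> s) (subst \<sigma> t)"

end

theory Submission imports Defs begin

text \<open>
  Write \<open>y\<close> for \<open>1/x\<close>. Differentiating \<open>x \<cdot> y\<close> and using (D3) gives \<open>\<partial>x \<cdot> y + x \<cdot> \<partial>y = 0\<close>.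
  Differentiating \<open>y = y \<cdot> (x \<cdot> y)\<close> in the same way gives \<open>\<partial>y = \<partial>y \<cdot> (x \<cdot> y)\<close>, so multiplying the
  first equation by \<open>y\<close> yields \<open>(y \<cdot> y) \<cdot> \<partial>x + \<partial>y = 0\<close>. Finally \<open>y \<cdot> y = 1/x\<^sup>2\<close>, since generalized
  inverses in a commutative semigroup are unique.
\<close>

section \<open>Calculational reasoning and instances of the meadow axioms\<close>

declare derivable.trans [trans]

lemma derivable_instance:
  assumes "(s, t) \<in> E" "wf_trm n s" "wf_trm n t" "\<And>v. wf_trm n (\<sigma> v)"
  shows "derivable n E (subst \<sigma> s) (subst \<sigma> t)"
  using assms by (blast intro: derivable.axiom derivable.subst)

text \<open>\<open>E\<close> may be any set of equations that contains the meadow axioms, so the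
  algebraic consequences carry over once the laws of derivations are added.\<close>

locale meadow_theory =
  fixes n :: nat and E :: "equation set"
  assumes Md_subset: "Md \<subseteq> E"
begin

abbreviation eqv :: "trm \<Rightarrow> trm \<Rightarrow> bool" (infix "\<approx>" 50) where
  "s \<approx> t \<equiv> derivable n E s t"

abbreviation wf :: "trm \<Rightarrow> bool" where
  "wf \<equiv> wf_trm n"

text \<open>Only the variables 0, 1 and 2 occur in the meadow axioms, so three terms determine an
  instance. All further variables are sent to \<open>c\<close> because the rule \<open>subst\<close>
  demands a well-formed value at every variable.\<close>

lemma Md_instance:
  assumes "(s, t) \<in> Md" "wf s" "wf t" "wf a" "wf b" "wf c"
  defines "\<sigma> \<equiv> \<lambda>v. if v = 0 then a else if v = 1 then b else c"
  shows "subst \<sigma> s \<approx> subst \<sigma> t"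
  using assms Md_subset by (intro derivable_instance) auto

lemma add_assoc: "wf a \<Longrightarrow> wf b \<Longrightarrow> wf c \<Longrightarrow> (a \<^bold>+ b) \<^bold>+ c \<approx> a \<^bold>+ (b \<^bold>+ c)"
  using Md_instance[of "(Var 0 \<^bold>+ Var 1) \<^bold>+ Var 2" "Var 0 \<^bold>+ (Var 1 \<^bold>+ Var 2)" a b c]
  by (simp add: Md_def Let_def)

lemma add_commute: "wf a \<Longrightarrow> wf b \<Longrightarrow> a \<^bold>+ b \<approx> b \<^bold>+ a"
  using Md_instance[of "Var 0 \<^bold>+ Var 1" "Var 1 \<^bold>+ Var 0" a b b] by (simp add: Md_def Let_def)

lemma add_zero: "wf a \<Longrightarrow> a \<^bold>+ \<^bold>0 \<approx> a"
  using Md_instance[of "Var 0 \<^bold>+ \<^bold>0" "Var 0" a a a] by (simp add: Md_def Let_def)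

lemma add_neg: "wf a \<Longrightarrow> a \<^bold>+ (\<^bold>- a) \<approx> \<^bold>0"
  using Md_instance[of "Var 0 \<^bold>+ (\<^bold>- Var 0)" "\<^bold>0" a a a] by (simp add: Md_def Let_def)

lemma mul_assoc: "wf a \<Longrightarrow> wf b \<Longrightarrow> wf c \<Longrightarrow> (a \<^bold>\<cdot> b) \<^bold>\<cdot> c \<approx> a \<^bold>\<cdot> (b \<^bold>\<cdot> c)"
  using Md_instance[of "(Var 0 \<^bold>\<cdot> Var 1) \<^bold>\<cdot> Var 2" "Var 0 \<^bold>\<cdot> (Var 1 \<^bold>\<cdot> Var 2)" a b c]
  by (simp add: Md_def Let_def)

lemma mul_commute: "wf a \<Longrightarrow> wf b \<Longrightarrow> a \<^bold>\<cdot> b \<approx> b \<^bold>\<cdot> a"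
  using Md_instance[of "Var 0 \<^bold>\<cdot> Var 1" "Var 1 \<^bold>\<cdot> Var 0" a b b] by (simp add: Md_def Let_def)

lemma mul_add: "wf a \<Longrightarrow> wf b \<Longrightarrow> wf c \<Longrightarrow> a \<^bold>\<cdot> (b \<^bold>+ c) \<approx> a \<^bold>\<cdot> b \<^bold>+ a \<^bold>\<cdot> c"
  using Md_instance[of "Var 0 \<^bold>\<cdot> (Var 1 \<^bold>+ Var 2)" "Var 0 \<^bold>\<cdot> Var 1 \<^bold>+ Var 0 \<^bold>\<cdot> Var 2" a b c]
  by (simp add: Md_def Let_def)

lemma inv_inv: "wf a \<Longrightarrow> (a\<^bold>\<inverse>)\<^bold>\<inverse> \<approx> a"
  using Md_instance[of "((Var 0)\<^bold>\<inverse>)\<^bold>\<inverse>" "Var 0" a a a] by (simp add: Md_def Let_def)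

lemma mul_mul_inv: "wf a \<Longrightarrow> a \<^bold>\<cdot> (a \<^bold>\<cdot> a\<^bold>\<inverse>) \<approx> a"
  using Md_instance[of "Var 0 \<^bold>\<cdot> (Var 0 \<^bold>\<cdot> (Var 0)\<^bold>\<inverse>)" "Var 0" a a a] by (simp add: Md_def Let_def)

lemma add_cong_left: "a \<approx> b \<Longrightarrow> wf c \<Longrightarrow> a \<^bold>+ c \<approx> b \<^bold>+ c"
  by (simp add: derivable.cong_Add derivable.refl)

lemma add_cong_right: "a \<approx> b \<Longrightarrow> wf c \<Longrightarrow> c \<^bold>+ a \<approx> c \<^bold>+ b"
  by (simp add: derivable.cong_Add derivable.refl)

lemma mul_cong_left: "a \<approx> b \<Longrightarrow> wf c \<Longrightarrow> a \<^bold>\<cdot> c \<approx> b \<^bold>\<cdot> c"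
  by (simp add: derivable.cong_Mul derivable.refl)

lemma mul_cong_right: "a \<approx> b \<Longrightarrow> wf c \<Longrightarrow> c \<^bold>\<cdot> a \<approx> c \<^bold>\<cdot> b"
  by (simp add: derivable.cong_Mul derivable.refl)

section \<open>Consequences of the ring axioms\<close>

lemma add_left_cancel:
  assumes "wf a" "wf b" "wf c" "a \<^bold>+ b \<approx> a \<^bold>+ c"
  shows "b \<approx> c"
proof -
  have drop: "(\<^bold>- a) \<^bold>+ (a \<^bold>+ d) \<approx> d" if "wf d" for d
  proof -
    have "(\<^bold>- a) \<^bold>+ (a \<^bold>+ d) \<approx> ((\<^bold>- a) \<^bold>+ a) \<^bold>+ d"
      by (rule derivable.sym, rule add_assoc) (use assms that in auto)
    also have "\<dots> \<approx> (a \<^bold>+ (\<^bold>- a)) \<^bold>+ d"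
      by (intro add_cong_left add_commute) (use assms that in auto)
    also have "\<dots> \<approx> \<^bold>0 \<^bold>+ d"
      by (intro add_cong_left add_neg) (use assms that in auto)
    also have "\<dots> \<approx> d \<^bold>+ \<^bold>0"
      by (intro add_commute) (use that in auto)
    also have "\<dots> \<approx> d"
      by (intro add_zero that)
    finally show ?thesis .
  qed
  have "b \<approx> (\<^bold>- a) \<^bold>+ (a \<^bold>+ b)"
    by (intro derivable.sym[OF drop] assms)
  also have "\<dots> \<approx> (\<^bold>- a) \<^bold>+ (a \<^bold>+ c)"
    by (rule add_cong_right[OF assms(4)]) (use assms in auto)
  also have "\<dots> \<approx> c"
    by (intro drop assms)
  finally show ?thesis .
qed

lemma mul_zero:
  assumes "wf a"
  shows "a \<^bold>\<cdot> \<^bold>0 \<approx> \<^bold>0"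
\<comment> \<open>The summand to be cancelled is \<open>a \<cdot> 0\<close> itself.\<close>
proof (rule add_left_cancel)
  have "a \<^bold>\<cdot> \<^bold>0 \<^bold>+ a \<^bold>\<cdot> \<^bold>0 \<approx> a \<^bold>\<cdot> (\<^bold>0 \<^bold>+ \<^bold>0)"
    by (rule derivable.sym, rule mul_add) (use assms in auto)
  also have "\<dots> \<approx> a \<^bold>\<cdot> \<^bold>0"
    by (intro mul_cong_right add_zero) (use assms in auto)
  also have "\<dots> \<approx> a \<^bold>\<cdot> \<^bold>0 \<^bold>+ \<^bold>0"
    by (rule derivable.sym, rule add_zero) (use assms in auto)
  finally show "a \<^bold>\<cdot> \<^bold>0 \<^bold>+ a \<^bold>\<cdot> \<^bold>0 \<approx> a \<^bold>\<cdot> \<^bold>0 \<^bold>+ \<^bold>0" .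
qed (use assms in auto)

text \<open>Distributivity is given with the common factor on the left, so both products are
  commuted first. The minus sign stands on the first factor, as it does in the derivative of an
  inverse.\<close>

lemma mul_add_neg_mul:
  assumes "wf a" "wf b"
  shows "a \<^bold>\<cdot> b \<^bold>+ (\<^bold>- a) \<^bold>\<cdot> b \<approx> \<^bold>0"
proof -
  have "a \<^bold>\<cdot> b \<^bold>+ (\<^bold>- a) \<^bold>\<cdot> b \<approx> b \<^bold>\<cdot> a \<^bold>+ b \<^bold>\<cdot> (\<^bold>- a)"
    by (intro derivable.cong_Add mul_commute) (use assms in auto)
  also have "\<dots> \<approx> b \<^bold>\<cdot> (a \<^bold>+ (\<^bold>- a))"
    by (rule derivable.sym, rule mul_add) (use assms in auto)
  also have "\<dots> \<approx> b \<^bold>\<cdot> \<^bold>0"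
    by (intro mul_cong_right add_neg assms)
  also have "\<dots> \<approx> \<^bold>0"
    by (intro mul_zero assms)
  finally show ?thesis .
qed

section \<open>Commutative semigroups and generalized inverses\<close>

lemma mul_left_commute:
  assumes "wf a" "wf b" "wf c"
  shows "a \<^bold>\<cdot> (b \<^bold>\<cdot> c) \<approx> b \<^bold>\<cdot> (a \<^bold>\<cdot> c)"
proof -
  have "a \<^bold>\<cdot> (b \<^bold>\<cdot> c) \<approx> (a \<^bold>\<cdot> b) \<^bold>\<cdot> c"
    by (rule derivable.sym, rule mul_assoc) (use assms in auto)
  also have "\<dots> \<approx> (b \<^bold>\<cdot> a) \<^bold>\<cdot> c"
    by (intro mul_cong_left mul_commute assms)
  also have "\<dots> \<approx> b \<^bold>\<cdot> (a \<^bold>\<cdot> c)"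
    by (intro mul_assoc assms)
  finally show ?thesis .
qed

text \<open>For \<open>a = b\<close> and \<open>c = d\<close> this is the multiplicativity of
  squaring, which is how it is used below.\<close>

lemma mul_interchange:
  assumes "wf a" "wf b" "wf c" "wf d"
  shows "(a \<^bold>\<cdot> b) \<^bold>\<cdot> (c \<^bold>\<cdot> d) \<approx> (a \<^bold>\<cdot> c) \<^bold>\<cdot> (b \<^bold>\<cdot> d)"
proof -
  have "(a \<^bold>\<cdot> b) \<^bold>\<cdot> (c \<^bold>\<cdot> d) \<approx> a \<^bold>\<cdot> (b \<^bold>\<cdot> (c \<^bold>\<cdot> d))"
    by (intro mul_assoc) (use assms in auto)
  also have "\<dots> \<approx> a \<^bold>\<cdot> (c \<^bold>\<cdot> (b \<^bold>\<cdot> d))"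
    by (intro mul_cong_right mul_left_commute assms)
  also have "\<dots> \<approx> (a \<^bold>\<cdot> c) \<^bold>\<cdot> (b \<^bold>\<cdot> d)"
    by (rule derivable.sym, rule mul_assoc) (use assms in auto)
  finally show ?thesis .
qed

text \<open>Both \<open>a \<cdot> b\<close> and \<open>a \<cdot> c\<close> act as units on the
  multiples of \<open>a\<close>, and both are such multiples, so they coincide. Then \<open>b = b
  \<cdot> (a \<cdot> c) = c \<cdot> (a \<cdot> b) = c \<cdot> (a \<cdot> c) = c\<close>.\<close>

lemma generalized_inverse_unique:
  assumes wf: "wf a" "wf b" "wf c"
    and ab: "a \<^bold>\<cdot> (a \<^bold>\<cdot> b) \<approx> a" and ba: "b \<^bold>\<cdot> (b \<^bold>\<cdot> a) \<approx> b"
    and ac: "a \<^bold>\<cdot> (a \<^bold>\<cdot> c) \<approx> a" and ca: "c \<^bold>\<cdot> (c \<^bold>\<cdot> a) \<approx> c"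
  shows "b \<approx> c"
proof -
  \<comment> \<open>The third assumption says that \<open>a \<cdot> e\<close> fixes \<open>a\<close>
    under multiplication; hence it fixes every multiple \<open>a \<cdot> d\<close>.\<close>
  have swap: "(a \<^bold>\<cdot> d) \<^bold>\<cdot> (a \<^bold>\<cdot> e) \<approx> a \<^bold>\<cdot> d"
    if "wf d" "wf e" "a \<^bold>\<cdot> (a \<^bold>\<cdot> e) \<approx> a" for d e
  proof -
    have "(a \<^bold>\<cdot> d) \<^bold>\<cdot> (a \<^bold>\<cdot> e) \<approx> (a \<^bold>\<cdot> e) \<^bold>\<cdot> (a \<^bold>\<cdot> d)"
      by (intro mul_commute) (use wf that in auto)
    also have "\<dots> \<approx> a \<^bold>\<cdot> ((a \<^bold>\<cdot> e) \<^bold>\<cdot> d)"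
      by (intro mul_left_commute) (use wf that in auto)
    also have "\<dots> \<approx> (a \<^bold>\<cdot> (a \<^bold>\<cdot> e)) \<^bold>\<cdot> d"
      by (rule derivable.sym, rule mul_assoc) (use wf that in auto)
    also have "\<dots> \<approx> a \<^bold>\<cdot> d"
      by (intro mul_cong_left that)
    finally show ?thesis .
  qed
  have eq: "a \<^bold>\<cdot> b \<approx> a \<^bold>\<cdot> c"
  proof -
    have "a \<^bold>\<cdot> b \<approx> (a \<^bold>\<cdot> b) \<^bold>\<cdot> (a \<^bold>\<cdot> c)"
      by (intro derivable.sym[OF swap] wf ac)
    also have "\<dots> \<approx> (a \<^bold>\<cdot> c) \<^bold>\<cdot> (a \<^bold>\<cdot> b)"
      by (intro mul_commute) (use wf in auto)
    also have "\<dots> \<approx> a \<^bold>\<cdot> c"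
      by (intro swap wf ab)
    finally show ?thesis .
  qed
  have "b \<approx> b \<^bold>\<cdot> (b \<^bold>\<cdot> a)"
    by (rule derivable.sym[OF ba])
  also have "\<dots> \<approx> b \<^bold>\<cdot> (a \<^bold>\<cdot> b)"
    by (intro mul_cong_right mul_commute wf)
  also have "\<dots> \<approx> b \<^bold>\<cdot> (a \<^bold>\<cdot> c)"
    by (intro mul_cong_right eq wf)
  also have "\<dots> \<approx> b \<^bold>\<cdot> (c \<^bold>\<cdot> a)"
    by (intro mul_cong_right mul_commute wf)
  \<comment> \<open>Now \<open>b\<close> and \<open>c\<close> change places, so that
    \<open>a \<cdot> b\<close> reappears and \<open>eq\<close> applies a second time.\<close>
  also have "\<dots> \<approx> c \<^bold>\<cdot> (b \<^bold>\<cdot> a)"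
    by (intro mul_left_commute wf)
  also have "\<dots> \<approx> c \<^bold>\<cdot> (a \<^bold>\<cdot> b)"
    by (intro mul_cong_right mul_commute wf)
  also have "\<dots> \<approx> c \<^bold>\<cdot> (a \<^bold>\<cdot> c)"
    by (intro mul_cong_right eq wf)
  also have "\<dots> \<approx> c \<^bold>\<cdot> (c \<^bold>\<cdot> a)"
    by (intro mul_cong_right mul_commute wf)
  also have "\<dots> \<approx> c"
    by (rule ca)
  finally show ?thesis .
qed

text \<open>Since inversion is an involution, the law \<open>x \<cdot> (x \<cdot> 1/x) = x\<close>
  at the inverse of \<open>a\<close> shows that \<open>a\<close> is in turn a generalized inverse of
  its inverse.\<close>

lemma inv_mul_inv_mul:
  assumes "wf a"
  shows "a\<^bold>\<inverse> \<^bold>\<cdot> (a\<^bold>\<inverse> \<^bold>\<cdot> a) \<approx> a\<^bold>\<inverse>"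
proof -
  have "a\<^bold>\<inverse> \<^bold>\<cdot> (a\<^bold>\<inverse> \<^bold>\<cdot> a) \<approx> a\<^bold>\<inverse> \<^bold>\<cdot> (a\<^bold>\<inverse> \<^bold>\<cdot> (a\<^bold>\<inverse>)\<^bold>\<inverse>)"
    by (intro mul_cong_right derivable.sym[OF inv_inv]) (use assms in auto)
  also have "\<dots> \<approx> a\<^bold>\<inverse>"
    by (intro mul_mul_inv) (use assms in auto)
  finally show ?thesis .
qed

text \<open>Both sides are generalized inverses of \<open>Sq a\<close>: the left one by the meadow
  laws, the right one because squaring is multiplicative and so preserves the defining
  identities.\<close>

lemma inv_Sq:
  assumes "wf a"
  shows "(Sq a)\<^bold>\<inverse> \<approx> Sq (a\<^bold>\<inverse>)"
proof (rule generalized_inverse_unique)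
  have square: "Sq d \<^bold>\<cdot> (Sq d \<^bold>\<cdot> Sq e) \<approx> Sq d" if "wf d" "wf e" "d \<^bold>\<cdot> (d \<^bold>\<cdot> e) \<approx> d" for d e
  proof -
    have "Sq d \<^bold>\<cdot> (Sq d \<^bold>\<cdot> Sq e) \<approx> Sq d \<^bold>\<cdot> Sq (d \<^bold>\<cdot> e)"
      by (intro mul_cong_right mul_interchange) (use that in auto)
    also have "\<dots> \<approx> Sq (d \<^bold>\<cdot> (d \<^bold>\<cdot> e))"
      by (intro mul_interchange) (use that in auto)
    also have "\<dots> \<approx> Sq d"
      by (intro derivable.cong_Mul that)
    finally show ?thesis .
  qed
  show "Sq a \<^bold>\<cdot> (Sq a \<^bold>\<cdot> Sq (a\<^bold>\<inverse>)) \<approx> Sq a"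
    using assms by (intro square mul_mul_inv) auto
  show "Sq (a\<^bold>\<inverse>) \<^bold>\<cdot> (Sq (a\<^bold>\<inverse>) \<^bold>\<cdot> Sq a) \<approx> Sq (a\<^bold>\<inverse>)"
    using assms by (intro square inv_mul_inv_mul) auto
qed (use assms in \<open>auto intro: mul_mul_inv inv_mul_inv_mul\<close>)

end

section \<open>The derivative of an inverse\<close>

locale differential_meadow_theory = meadow_theory +
  assumes DE_subset: "DE n \<subseteq> E"
begin

lemma Pd_mul:
  assumes "i \<in> {1..n}" "wf a" "wf b"
  shows "Pd i (a \<^bold>\<cdot> b) \<approx> Pd i a \<^bold>\<cdot> b \<^bold>+ a \<^bold>\<cdot> Pd i b"
proof -
  have "(Pd i (Var 0 \<^bold>\<cdot> Var 1), Pd i (Var 0) \<^bold>\<cdot> Var 1 \<^bold>+ Var 0 \<^bold>\<cdot> Pd i (Var 1)) \<in> E"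
    using DE_subset assms(1) by (auto simp: DE_def Let_def)
  from derivable_instance[OF this, of n "\<lambda>v. if v = 0 then a else b"] show ?thesis
    using assms by simp
qed

lemma Pd_mul_inv:
  assumes "i \<in> {1..n}" "wf a"
  shows "Pd i (a \<^bold>\<cdot> a\<^bold>\<inverse>) \<approx> \<^bold>0"
proof -
  have "(Pd i (Var 0 \<^bold>\<cdot> (Var 0)\<^bold>\<inverse>), \<^bold>0) \<in> E"
    using DE_subset assms(1) by (auto simp: DE_def Let_def)
  from derivable_instance[OF this, of n "\<lambda>_. a"] show ?thesis
    using assms by simp
qed

text \<open>The inverse of \<open>a\<close> is fixed by the factor \<open>a \<cdot> 1/a\<close>,
  whose derivative vanishes by (D3), so its derivative is fixed by that factor too. The bracketing
  on the left is the one that arises when \<open>a \<cdot> Pd i (1/a)\<close> from the product rule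
  is multiplied by \<open>1/a\<close>.\<close>

lemma Pd_inv_absorb:
  assumes "i \<in> {1..n}" "wf a"
  shows "a\<^bold>\<inverse> \<^bold>\<cdot> (a \<^bold>\<cdot> Pd i (a\<^bold>\<inverse>)) \<approx> Pd i (a\<^bold>\<inverse>)"
proof -
  let ?y = "a\<^bold>\<inverse>" and ?e = "a \<^bold>\<cdot> a\<^bold>\<inverse>"
  have "?y \<^bold>\<cdot> (a \<^bold>\<cdot> Pd i ?y) \<approx> a \<^bold>\<cdot> (?y \<^bold>\<cdot> Pd i ?y)"
    by (intro mul_left_commute) (use assms in auto)
  also have "\<dots> \<approx> ?e \<^bold>\<cdot> Pd i ?y"
    by (rule derivable.sym, rule mul_assoc) (use assms in auto)
  also have "\<dots> \<approx> Pd i ?y \<^bold>\<cdot> ?e"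
    by (intro mul_commute) (use assms in auto)
  \<comment> \<open>The added zero is turned into \<open>?y \<cdot> Pd i ?e\<close>, which completes
    the product rule for \<open>?y \<cdot> ?e\<close>.\<close>
  also have "\<dots> \<approx> Pd i ?y \<^bold>\<cdot> ?e \<^bold>+ \<^bold>0"
    by (rule derivable.sym, rule add_zero) (use assms in auto)
  also have "\<dots> \<approx> Pd i ?y \<^bold>\<cdot> ?e \<^bold>+ ?y \<^bold>\<cdot> \<^bold>0"
    by (intro add_cong_right derivable.sym[OF mul_zero]) (use assms in auto)
  also have "\<dots> \<approx> Pd i ?y \<^bold>\<cdot> ?e \<^bold>+ ?y \<^bold>\<cdot> Pd i ?e"
    by (intro add_cong_right mul_cong_right derivable.sym[OF Pd_mul_inv]) (use assms in auto)
  also have "\<dots> \<approx> Pd i (?y \<^bold>\<cdot> ?e)"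
    by (intro derivable.sym[OF Pd_mul]) (use assms in auto)
  also have "\<dots> \<approx> Pd i (?y \<^bold>\<cdot> (?y \<^bold>\<cdot> a))"
    by (intro derivable.cong_Pd mul_cong_right mul_commute) (use assms in auto)
  also have "\<dots> \<approx> Pd i ?y"
    by (intro derivable.cong_Pd inv_mul_inv_mul assms)
  finally show ?thesis .
qed

text \<open>Both sides are additive opposites of \<open>?w \<cdot> Pd i a\<close>, where
  \<open>?w\<close> is the inverse of \<open>Sq a\<close>; cancelling that summand identifies
  them.\<close>

theorem Pd_inv:
  assumes "i \<in> {1..n}" "wf a"
  shows "Pd i (a\<^bold>\<inverse>) \<approx> (\<^bold>- (Sq a)\<^bold>\<inverse>) \<^bold>\<cdot> Pd i a"
proof -
  let ?y = "a\<^bold>\<inverse>" and ?w = "(Sq a)\<^bold>\<inverse>"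
  have "?w \<^bold>\<cdot> Pd i a \<approx> Sq ?y \<^bold>\<cdot> Pd i a"
    by (intro mul_cong_left inv_Sq) (use assms in auto)
  also have "\<dots> \<approx> ?y \<^bold>\<cdot> (?y \<^bold>\<cdot> Pd i a)"
    by (intro mul_assoc) (use assms in auto)
  also have "\<dots> \<approx> ?y \<^bold>\<cdot> (Pd i a \<^bold>\<cdot> ?y)"
    by (intro mul_cong_right mul_commute) (use assms in auto)
  \<comment> \<open>\<open>Pd_inv_absorb\<close>, read from right to left, gives the second summand
    the factor \<open>?y\<close> too. What remains after factoring it out is the product rule for
    \<open>a \<cdot> ?y\<close>.\<close>
  finally have "?w \<^bold>\<cdot> Pd i a \<^bold>+ Pd i ?y \<approx> ?y \<^bold>\<cdot> (Pd i a \<^bold>\<cdot> ?y) \<^bold>+ ?y \<^bold>\<cdot> (a \<^bold>\<cdot> Pd i ?y)"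
    by (intro derivable.cong_Add derivable.sym[OF Pd_inv_absorb] assms)
  also have "\<dots> \<approx> ?y \<^bold>\<cdot> (Pd i a \<^bold>\<cdot> ?y \<^bold>+ a \<^bold>\<cdot> Pd i ?y)"
    by (intro derivable.sym[OF mul_add]) (use assms in auto)
  also have "\<dots> \<approx> ?y \<^bold>\<cdot> Pd i (a \<^bold>\<cdot> ?y)"
    by (intro mul_cong_right derivable.sym[OF Pd_mul]) (use assms in auto)
  also have "\<dots> \<approx> ?y \<^bold>\<cdot> \<^bold>0"
    by (intro mul_cong_right Pd_mul_inv) (use assms in auto)
  also have "\<dots> \<approx> \<^bold>0"
    by (intro mul_zero) (use assms in auto)
  \<comment> \<open>Zero is expanded so that both ends of the chain share the summand to be
    cancelled.\<close>
  also have "\<dots> \<approx> ?w \<^bold>\<cdot> Pd i a \<^bold>+ (\<^bold>- ?w) \<^bold>\<cdot> Pd i a"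
    by (rule derivable.sym, rule mul_add_neg_mul) (use assms in auto)
  finally show ?thesis
    \<comment> \<open>The rotation moves the equation to the front of the premises, where the
      chained fact can discharge it.\<close>
    by (rule add_left_cancel[rotated -1]) (use assms in auto)
qed

end

theorem proposition1:
  fixes n i x :: nat
  assumes "n \<ge> 1" and "i \<in> {1..n}"
  shows "derivable n (Md \<union> DE n)
           (Pd i ((Var x)\<^bold>\<inverse>))
           ((\<^bold>- (Sq (Var x))\<^bold>\<inverse>) \<^bold>\<cdot> Pd i (Var x))"
proof -
  \<comment> \<open>Taking for \<open>E\<close> exactly the given axioms makes the claim the
    instance of \<open>Pd_inv\<close> at a variable.\<close>
  interpret differential_meadow_theory n "Md \<union> DE n"
    by unfold_locales auto
  show ?thesis
    using assms by (intro Pd_inv) auto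
qed

end
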